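(* For every $k$ and every $f\in\mathrm{RPP}^k$ (with any derivation of $f\in\mathrm{RPP}^k$ used to build the encoding), $\vdash_\omega \mathrm{isos}(f) : Z^k\leftrightarrow Z^k$.
   Context: RPP (Reversible Primitive Permutations): $\mathrm{RPP}^k$ is a set of functions $\mathbb{Z}^k\to\mathbb{Z}^k$ defined inductively: the primitives $S,P,\mathrm{Id},\mathrm{Sign}\in\mathrm{RPP}^1$ with $S(x)=x+1$, $P(x)=x-1$, $\mathrm{Id}(x)=x$, $\mathrm{Sign}(x)=-x$, and $\mathcal{X}\in\mathrm{RPP}^2$ with $\mathcal{X}(x,y)=(y,x)$; and for $f,g,h\in\mathrm{RPP}^k$, $j\in\mathrm{RPP}^l$: sequential composition $f;g\in\mathrm{RPP}^k$ ($x\mapsto g(f(x))$), parallel composition $f\parallel j\in\mathrm{RPP}^{k+l}$ ($(\vec x,\vec y)\mapsto(f(\vec x),j(\vec y))$), iteration $\mathbf{It}[f]\in\mathrm{RPP}^{k+1}$ with $\mathbf{It}[f](\vec x,x)=(f^{|x|}(\vec x),x)$, and selection $\mathbf{If}[f,g,h]\in\mathrm{RPP}^{k+1}$ with $\mathbf{If}[f,g,h](\vec x,x)=(f(\vec x),x)$ if $x>0$, $(g(\vec x),x)$ if $x=0$, $(h(\vec x),x)$ if $x<0$. Language: types $A ::= \mathbb{1}\mid A\oplus B\mid A\otimes B\mid\mu X.A\mid X$ (closed); values $v ::= ()\mid x\mid\mathtt{inl}\,v\mid\mathtt{inr}\,v\mid\langle v_1,v_2\rangle\mid\mathtt{fold}\,v$;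 patterns $p::=x\mid\langle p_1,p_2\rangle$; expressions $e::=v\mid\mathtt{let}\,p_1=\omega\,p_2\,\mathtt{in}\,e$; isos $\omega::=\{v_1\leftrightarrow e_1\mid\dots\mid v_n\leftrightarrow e_n\}\mid\mathtt{fix}\,g.\omega\mid g$; $(x_1,\dots,x_n)=\langle x_1,\langle\dots,x_n\rangle\rangle$, $\vec x$ a tuple of distinct variables, $A^n=A\otimes\dots\otimes A$ ($n$ factors, right-nested). Typing of terms $\Delta;\Psi\vdash_e t:A$ ($\Delta$ linear context of term variables, $\Psi$ empty or one iso-variable $g:\alpha$): $\emptyset;\Psi\vdash_e():\mathbb{1}$; $x:A;\Psi\vdash_e x:A$; $\mathtt{inl}/\mathtt{inr}$ into $A\oplus B$ from $A$ resp. $B$; pairs split the context between components into $A\otimes B$; $\mathtt{fold}\,t:\mu X.A$ from $t:A[X\leftarrow\mu X.A]$; $\omega\,t:B$ from $t:A$ and either $\omega=g$ with $\Psi\vdash_\omega g:A\leftrightarrow B$ or $\vdash_\omega\omega:A\leftrightarrow B$ with empty iso-context; $\mathtt{let}\,(x_1,\dots,x_n)=t_1\,\mathtt{in}\,t_2:B$ under $\Delta_1,\Delta_2$ from $\Delta_1;\Psi\vdash_e t_1:A_1\otimes\dots\otimes A_n$ and $\Delta_2,x_1:A_1,\dots,x_n:A_n;\Psi\vdash_e t_2:B$. Typing of isos: $\Psi\vdash_\omega\{v_i\leftrightarrow e_i\}_i:A\leftrightarrow B$ if $\Delta_i\vdash_e v_i:A$, $\Delta_i;\Psi\vdash_e e_i:B$,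 $\mathtt{OD}_A(\{v_i\})$ and $\mathtt{OD}_B(\{Val(e_i)\})$ ($Val$ strips the lets); $g:\alpha\vdash_\omega g:\alpha$; $\Psi\vdash_\omega\mathtt{fix}\,g.\omega:\alpha$ if $g:\alpha\vdash_\omega\omega:\alpha$ and $\mathtt{fix}\,g.\omega$ is structurally recursive, i.e. $\omega=\{v_i\leftrightarrow e_i\}:A_1\otimes\dots\otimes A_m\leftrightarrow C$ and there is $j$ with $A_j=\mu X.B$ such that each $v_i=(v_i^1,\dots,v_i^m)$ and either $v_i^j$ is closed and $e_i$ has no subterm $g\,p$, or every subterm $g\,p$ of $e_i$ has $p=(x_1,\dots,x_m)$ with $x_j$ a strict subterm of $v_i^j$. $\mathtt{OD}_A(S)$: $\mathtt{OD}_A(\{x\})$; $\mathtt{OD}_{\mathbb{1}}(\{()\})$; $\mathtt{OD}_{A\oplus B}(\{\mathtt{inl}\,v\mid v\in S\}\cup\{\mathtt{inr}\,v\mid v\in T\})$ if $\mathtt{OD}_A(S),\mathtt{OD}_B(T)$; $\mathtt{OD}_{\mu X.A}(\{\mathtt{fold}\,v\mid v\in S\})$ if $\mathtt{OD}_{A[X\leftarrow\mu X.A]}(S)$; $\mathtt{OD}_{A\otimes B}(S)$ if either $\mathtt{OD}_A(\pi_1S)$ and $\forall v\in\pi_1 S$, $\mathtt{OD}_B(\{w\mid\langle v,w\rangle\in S\})$, or symmetrically on the second component. Encoding: $\mathrm{npos}=\mu X.\mathbb{1}\oplus X$, $Z=\mathbb{1}\oplus(\mathrm{npos}\oplus\mathrm{npos})$.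 $\mathrm{isos}(f)$ is defined by induction on the derivation of $f\in\mathrm{RPP}^k$: $\mathrm{isos}(\mathrm{Id})=\{x\leftrightarrow x\}$; $\mathrm{isos}(\mathcal{X})=\{(x,y)\leftrightarrow(y,x)\}$; $\mathrm{isos}(\mathrm{Sign})=\{\mathtt{inr}(\mathtt{inl}\,x)\leftrightarrow\mathtt{inr}(\mathtt{inr}\,x)\mid\mathtt{inr}(\mathtt{inr}\,x)\leftrightarrow\mathtt{inr}(\mathtt{inl}\,x)\mid\mathtt{inl}()\leftrightarrow\mathtt{inl}()\}$; $\mathrm{isos}(S)=\{\mathtt{inl}()\leftrightarrow\mathtt{inr}(\mathtt{inl}(\mathtt{fold}(\mathtt{inl}())))\mid\mathtt{inr}(\mathtt{inl}\,x)\leftrightarrow\mathtt{inr}(\mathtt{inl}(\mathtt{fold}(\mathtt{inr}\,x)))\mid\mathtt{inr}(\mathtt{inr}(\mathtt{fold}(\mathtt{inl}())))\leftrightarrow\mathtt{inl}()\mid\mathtt{inr}(\mathtt{inr}(\mathtt{fold}(\mathtt{inr}\,x)))\leftrightarrow\mathtt{inr}(\mathtt{inr}\,x)\}$; $\mathrm{isos}(P)$ is the same set of clauses with the two sides of each clause swapped. With $\omega_f=\mathrm{isos}(f)$ etc.: $\mathrm{isos}(f;g)=\{\vec x\leftrightarrow\mathtt{let}\,\vec y=\omega_f\,\vec x\,\mathtt{in}\,\mathtt{let}\,\vec z=\omega_g\,\vec y\,\mathtt{in}\,\vec z\}$; $\mathrm{isos}(f\parallel g)=\{(x_1,\dots,x_j,y_1,\dots,y_k)\leftrightarrow\mathtt{let}\,(x_1',\dots,x_j')=\omega_f(x_1,\dots,x_j)\,\mathtt{in}\,\mathtt{let}\,(y_1',\dots,y_k')=\omega_g(y_1,\dots,y_k)\,\mathtt{in}\,(x_1',\dots,x_j',y_1',\dots,y_k')\}$;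 for $f\in\mathrm{RPP}^k$, $\omega_{aux}:Z^k\otimes\mathrm{npos}\leftrightarrow Z^k\otimes\mathrm{npos}$ is $\mathtt{fix}\,g.\{(\vec x,\mathtt{fold}(\mathtt{inl}()))\leftrightarrow\mathtt{let}\,\vec y=\omega_f\,\vec x\,\mathtt{in}\,(\vec y,\mathtt{fold}(\mathtt{inl}()))\mid(\vec x,\mathtt{fold}(\mathtt{inr}\,n))\leftrightarrow\mathtt{let}\,\vec y=\omega_f\,\vec x\,\mathtt{in}\,\mathtt{let}\,(\vec z,n')=g\,(\vec y,n)\,\mathtt{in}\,(\vec z,\mathtt{fold}(\mathtt{inr}\,n'))\}$ and $\mathrm{isos}(\mathbf{It}[f])=\{(\vec x,\mathtt{inl}())\leftrightarrow(\vec x,\mathtt{inl}())\mid(\vec x,\mathtt{inr}(\mathtt{inl}\,z))\leftrightarrow\mathtt{let}\,(\vec y,z')=\omega_{aux}(\vec x,z)\,\mathtt{in}\,(\vec y,\mathtt{inr}(\mathtt{inl}\,z'))\mid(\vec x,\mathtt{inr}(\mathtt{inr}\,z))\leftrightarrow\mathtt{let}\,(\vec y,z')=\omega_{aux}(\vec x,z)\,\mathtt{in}\,(\vec y,\mathtt{inr}(\mathtt{inr}\,z'))\}$; $\mathrm{isos}(\mathbf{If}[f,g,h])=\{(\vec x,\mathtt{inr}(\mathtt{inl}\,z))\leftrightarrow\mathtt{let}\,\vec x'=\omega_f\,\vec x\,\mathtt{in}\,(\vec x',\mathtt{inr}(\mathtt{inl}\,z))\mid(\vec x,\mathtt{inl}())\leftrightarrow\mathtt{let}\,\vec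 x'=\omega_g\,\vec x\,\mathtt{in}\,(\vec x',\mathtt{inl}())\mid(\vec x,\mathtt{inr}(\mathtt{inr}\,z))\leftrightarrow\mathtt{let}\,\vec x'=\omega_h\,\vec x\,\mathtt{in}\,(\vec x',\mathtt{inr}(\mathtt{inr}\,z))\}$. In each case $\vec x,\vec y,\vec z,\vec x'$ are tuples of $k$ distinct fresh variables (of the appropriate length). *)

theory Defs
  imports Main "HOL-Library.FuncSet"
begin

text \<open>
  Right-nested tuples \<open>(a\<^sub>1, \<dots>, a\<^sub>n) = \<langle>a\<^sub>1, \<langle>\<dots>, a\<^sub>n\<rangle>\<rangle>\<close> over an arbitrary pairing
  operation; they are used for types, values and patterns. The 1-tuple is its only component, and
  the tuple of the empty list is unspecified (it is never used).
\<close>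

fun ntuple :: "('a \<Rightarrow> 'a \<Rightarrow> 'a) \<Rightarrow> 'a list \<Rightarrow> 'a" where
  "ntuple c [a] = a"
| "ntuple c (a # b # as) = c a (ntuple c (b # as))"


section \<open>Types\<close>

text \<open>Bound type variables are de Bruijn indices: \<open>Mu A\<close> binds index 0 in \<open>A\<close>.\<close>

datatype ty =
    One
  | Sum ty ty (infixr "\<oplus>" 65)
  | Tensor ty ty (infixr "\<otimes>" 70)
  | Mu ty
  | TyVar nat

primrec ty_scoped :: "nat \<Rightarrow> ty \<Rightarrow> bool" where
  "ty_scoped n One \<longleftrightarrow> True"
| "ty_scoped n (A \<oplus> B) \<longleftrightarrow> ty_scoped n A \<and> ty_scoped n B"
| "ty_scoped n (A \<otimes> B) \<longleftrightarrow> ty_scoped n A \<and> ty_scoped n B"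
| "ty_scoped n (Mu A) \<longleftrightarrow> ty_scoped (Suc n) A"
| "ty_scoped n (TyVar i) \<longleftrightarrow> i < n"

abbreviation ty_closed :: "ty \<Rightarrow> bool" where
  "ty_closed \<equiv> ty_scoped 0"

primrec ty_lift :: "nat \<Rightarrow> ty \<Rightarrow> ty" where
  "ty_lift n One = One"
| "ty_lift n (A \<oplus> B) = ty_lift n A \<oplus> ty_lift n B"
| "ty_lift n (A \<otimes> B) = ty_lift n A \<otimes> ty_lift n B"
| "ty_lift n (Mu A) = Mu (ty_lift (Suc n) A)"
| "ty_lift n (TyVar i) = (if i < n then TyVar i else TyVar (Suc i))"

primrec ty_subst :: "nat \<Rightarrow> ty \<Rightarrow> ty \<Rightarrow> ty" where
  "ty_subst n C One = One"
| "ty_subst n C (A \<oplus> B) = ty_subst n C A \<oplus> ty_subst n C B"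
| "ty_subst n C (A \<otimes> B) = ty_subst n C A \<otimes> ty_subst n C B"
| "ty_subst n C (Mu A) = Mu (ty_subst (Suc n) (ty_lift 0 C) A)"
| "ty_subst n C (TyVar i) =
     (if i < n then TyVar i else if i = n then C else TyVar (i - 1))"

text \<open>\<open>unfold_mu A\<close> is \<open>A[X \<leftarrow> \<mu>X. A]\<close>.\<close>

definition unfold_mu :: "ty \<Rightarrow> ty" where
  "unfold_mu A = ty_subst 0 (Mu A) A"

abbreviation tensor :: "ty list \<Rightarrow> ty" where
  "tensor \<equiv> ntuple Tensor"

definition ty_power :: "ty \<Rightarrow> nat \<Rightarrow> ty" where
  "ty_power A k = tensor (replicate k A)"

datatype iso_ty = Iso_Ty ty ty (infix "\<leftrightarrow>" 60)


section \<open>Terms and isos\<close>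

type_synonym var = "string \<times> nat"
type_synonym ivar = string

datatype val =
    VUnit
  | VVar var
  | VInl val
  | VInr val
  | VPair val val
  | VFold val

datatype pat =
    PVar var
  | PPair pat pat

datatype exp =
    EVal val
  | ELet pat iso pat exp  \<comment> \<open>\<open>ELet p \<omega> q e\<close> is \<open>let p = \<omega> q in e\<close>\<close>
and iso =
    Clauses "(val \<times> exp) list"
  | Fix ivar iso
  | IVar ivar

datatype trm =
    TUnit
  | TVar var
  | TInl trm
  | TInr trm
  | TPair trm trm
  | TFold trm
  | TApp iso trm
  | TLet pat trm trm

text \<open>Patterns are values, and values and expressions are terms.\<close>

primrec val_of_pat :: "pat \<Rightarrow> val" where
  "val_of_pat (PVar x) = VVar x"
| "val_of_pat (PPair p q) = VPair (val_of_pat p) (val_of_pat q)"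

primrec trm_of_val :: "val \<Rightarrow> trm" where
  "trm_of_val VUnit = TUnit"
| "trm_of_val (VVar x) = TVar x"
| "trm_of_val (VInl v) = TInl (trm_of_val v)"
| "trm_of_val (VInr v) = TInr (trm_of_val v)"
| "trm_of_val (VPair v w) = TPair (trm_of_val v) (trm_of_val w)"
| "trm_of_val (VFold v) = TFold (trm_of_val v)"

fun trm_of_exp :: "exp \<Rightarrow> trm" where
  "trm_of_exp (EVal v) = trm_of_val v"
| "trm_of_exp (ELet p \<omega> q e) = TLet p (TApp \<omega> (trm_of_val (val_of_pat q))) (trm_of_exp e)"

fun Val :: "exp \<Rightarrow> val" where
  "Val (EVal v) = v"
| "Val (ELet p \<omega> q e) = Val e"

abbreviation vtuple :: "val list \<Rightarrow> val" where
  "vtuple \<equiv> ntuple VPair"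

abbreviation ptuple :: "var list \<Rightarrow> pat" where
  "ptuple xs \<equiv> ntuple PPair (map PVar xs)"

primrec val_vars :: "val \<Rightarrow> var set" where
  "val_vars VUnit = {}"
| "val_vars (VVar x) = {x}"
| "val_vars (VInl v) = val_vars v"
| "val_vars (VInr v) = val_vars v"
| "val_vars (VPair v w) = val_vars v \<union> val_vars w"
| "val_vars (VFold v) = val_vars v"

fun let_vars :: "exp \<Rightarrow> var set" where
  "let_vars (EVal v) = {}"
| "let_vars (ELet p \<omega> q e) = val_vars (val_of_pat p) \<union> let_vars e"

primrec strict_subvals :: "val \<Rightarrow> val set" where
  "strict_subvals VUnit = {}"
| "strict_subvals (VVar x) = {}"
| "strict_subvals (VInl v) = insert v (strict_subvals v)"
| "strict_subvals (VInr v) = insert v (strict_subvals v)"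
| "strict_subvals (VPair v w) = {v, w} \<union> strict_subvals v \<union> strict_subvals w"
| "strict_subvals (VFold v) = insert v (strict_subvals v)"

text \<open>
  The patterns \<open>p\<close> such that \<open>g p\<close> is a subterm of an expression, resp. iso. Occurrences of the name
  \<open>g\<close> below an inner binder \<open>fix g\<close> belong to that binder and are not counted.
\<close>

fun exp_calls :: "ivar \<Rightarrow> exp \<Rightarrow> pat set"
  and iso_calls :: "ivar \<Rightarrow> iso \<Rightarrow> pat set" where
  "exp_calls g (EVal v) = {}"
| "exp_calls g (ELet p \<omega> q e) =
     (if \<omega> = IVar g then {q} else {}) \<union> iso_calls g \<omega> \<union> exp_calls g e"
| "iso_calls g (Clauses cs) = (\<Union>(v, e) \<in> set cs. exp_calls g e)"
| "iso_calls g (Fix h \<omega>) = (if h = g then {} else iso_calls g \<omega>)"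
| "iso_calls g (IVar h) = {}"


section \<open>Typing\<close>

text \<open>
  In the rules for \<open>\<otimes>\<close>, a set of pairs \<open>S\<close> is given by the relation \<open>R\<close> with
  \<open>S = {\<langle>v, w\<rangle> | (v, w) \<in> R}\<close>.
\<close>

inductive OD :: "ty \<Rightarrow> val set \<Rightarrow> bool" where
  OD_var: "OD A {VVar x}"
| OD_One: "OD One {VUnit}"
| OD_Sum: "OD A S \<Longrightarrow> OD B T \<Longrightarrow> OD (A \<oplus> B) (VInl ` S \<union> VInr ` T)"
| OD_Mu: "OD (unfold_mu A) S \<Longrightarrow> OD (Mu A) (VFold ` S)"
| OD_Tensor_left:
    "OD A {v. \<exists>w. (v, w) \<in> R} \<Longrightarrow> (\<forall>v. (\<exists>w. (v, w) \<in> R) \<longrightarrow> OD B {w. (v, w) \<in> R}) \<Longrightarrow>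
     OD (A \<otimes> B) {VPair v w |v w. (v, w) \<in> R}"
| OD_Tensor_right:
    "OD B {w. \<exists>v. (v, w) \<in> R} \<Longrightarrow> (\<forall>w. (\<exists>v. (v, w) \<in> R) \<longrightarrow> OD A {v. (v, w) \<in> R}) \<Longrightarrow>
     OD (A \<otimes> B) {VPair v w |v w. (v, w) \<in> R}"

text \<open>
  \<open>structurally_recursive g A \<omega>\<close>: \<open>fix g. \<omega>\<close> is structurally recursive, for \<open>\<omega> : A \<leftrightarrow> C\<close>.
  The condition \<open>xs ! j \<notin> let_vars e\<close> says that the variable passed to \<open>g\<close> is the one
  bound by the left-hand side and not a homonymous variable bound by a \<open>let\<close> of \<open>e\<close>, which the
  usual variable convention excludes.
\<close>

definition structurally_recursive :: "ivar \<Rightarrow> ty \<Rightarrow> iso \<Rightarrow> bool" where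
  "structurally_recursive g A \<omega> \<longleftrightarrow>
     (\<exists>cs As j B. \<omega> = Clauses cs \<and> As \<noteq> [] \<and> A = tensor As \<and> j < length As \<and> As ! j = Mu B \<and>
       (\<forall>(v, e) \<in> set cs. \<exists>vs. length vs = length As \<and> v = vtuple vs \<and>
         (val_vars (vs ! j) = {} \<and> exp_calls g e = {} \<or>
          (\<forall>p \<in> exp_calls g e. \<exists>xs. length xs = length As \<and> p = ptuple xs \<and>
             VVar (xs ! j) \<in> strict_subvals (vs ! j) \<and> xs ! j \<notin> let_vars e))))"

text \<open>
  Linear contexts are partial maps; \<open>\<Delta>\<^sub>1, \<Delta>\<^sub>2\<close> is a union of maps with disjoint domains. The
  \<open>ty_closed\<close> premises make every derivable judgement range over closed types only.

  In rule \<open>iso_clauses\<close>, \<open>distinct\<close> makes explicit that the \<open>v\<^sub>i\<close> (resp. the \<open>Val(e\<^sub>i)\<close>) are pairwise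
  different: sets forget repetitions, and without it \<open>{x \<leftrightarrow> inl x | x \<leftrightarrow> inr x}\<close> would be typable.
\<close>

type_synonym ctxt = "var \<rightharpoonup> ty"
type_synonym ictxt = "(ivar \<times> iso_ty) option"

inductive trm_typing :: "ctxt \<Rightarrow> ictxt \<Rightarrow> trm \<Rightarrow> ty \<Rightarrow> bool"
    ("_,/ _ \<turnstile>\<^sub>e/ _ :/ _" [51, 51, 51, 51] 50)
  and iso_typing :: "ictxt \<Rightarrow> iso \<Rightarrow> iso_ty \<Rightarrow> bool"
    ("_ \<turnstile>\<^sub>\<omega>/ _ :/ _" [51, 51, 51] 50) where
  trm_Unit: "Map.empty, \<Psi> \<turnstile>\<^sub>e TUnit : One"
| trm_Var: "ty_closed A \<Longrightarrow> [x \<mapsto> A], \<Psi> \<turnstile>\<^sub>e TVar x : A"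
| trm_Inl: "\<Delta>, \<Psi> \<turnstile>\<^sub>e t : A \<Longrightarrow> ty_closed B \<Longrightarrow> \<Delta>, \<Psi> \<turnstile>\<^sub>e TInl t : A \<oplus> B"
| trm_Inr: "\<Delta>, \<Psi> \<turnstile>\<^sub>e t : B \<Longrightarrow> ty_closed A \<Longrightarrow> \<Delta>, \<Psi> \<turnstile>\<^sub>e TInr t : A \<oplus> B"
| trm_Pair:
    "\<Delta>\<^sub>1, \<Psi> \<turnstile>\<^sub>e t\<^sub>1 : A \<Longrightarrow> \<Delta>\<^sub>2, \<Psi> \<turnstile>\<^sub>e t\<^sub>2 : B \<Longrightarrow> dom \<Delta>\<^sub>1 \<inter> dom \<Delta>\<^sub>2 = {} \<Longrightarrow>
     \<Delta>\<^sub>1 ++ \<Delta>\<^sub>2, \<Psi> \<turnstile>\<^sub>e TPair t\<^sub>1 t\<^sub>2 : A \<otimes> B"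
| trm_Fold: "\<Delta>, \<Psi> \<turnstile>\<^sub>e t : unfold_mu A \<Longrightarrow> ty_closed (Mu A) \<Longrightarrow> \<Delta>, \<Psi> \<turnstile>\<^sub>e TFold t : Mu A"
| trm_App_var:
    "\<Psi> \<turnstile>\<^sub>\<omega> IVar g : A \<leftrightarrow> B \<Longrightarrow> \<Delta>, \<Psi> \<turnstile>\<^sub>e t : A \<Longrightarrow> \<Delta>, \<Psi> \<turnstile>\<^sub>e TApp (IVar g) t : B"
| trm_App: "None \<turnstile>\<^sub>\<omega> \<omega> : A \<leftrightarrow> B \<Longrightarrow> \<Delta>, \<Psi> \<turnstile>\<^sub>e t : A \<Longrightarrow> \<Delta>, \<Psi> \<turnstile>\<^sub>e TApp \<omega> t : B"
| trm_Let:
    "\<Delta>\<^sub>1, \<Psi> \<turnstile>\<^sub>e t\<^sub>1 : tensor As \<Longrightarrow> \<Delta>\<^sub>2 ++ map_of (zip xs As), \<Psi> \<turnstile>\<^sub>e t\<^sub>2 : B \<Longrightarrow>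
     xs \<noteq> [] \<Longrightarrow> length xs = length As \<Longrightarrow> distinct xs \<Longrightarrow> dom \<Delta>\<^sub>2 \<inter> set xs = {} \<Longrightarrow>
     dom \<Delta>\<^sub>1 \<inter> dom \<Delta>\<^sub>2 = {} \<Longrightarrow> \<Delta>\<^sub>1 ++ \<Delta>\<^sub>2, \<Psi> \<turnstile>\<^sub>e TLet (ptuple xs) t\<^sub>1 t\<^sub>2 : B"
| iso_clauses:
    "(\<forall>(v, e) \<in> set cs. \<exists>\<Delta>. (\<Delta>, None \<turnstile>\<^sub>e trm_of_val v : A) \<and> (\<Delta>, \<Psi> \<turnstile>\<^sub>e trm_of_exp e : B)) \<Longrightarrow>
     distinct (map fst cs) \<Longrightarrow> OD A (fst ` set cs) \<Longrightarrow>
     distinct (map (Val \<circ> snd) cs) \<Longrightarrow> OD B ((Val \<circ> snd) ` set cs) \<Longrightarrow>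
     \<Psi> \<turnstile>\<^sub>\<omega> Clauses cs : A \<leftrightarrow> B"
| iso_var: "ty_closed A \<Longrightarrow> ty_closed B \<Longrightarrow> Some (g, A \<leftrightarrow> B) \<turnstile>\<^sub>\<omega> IVar g : A \<leftrightarrow> B"
| iso_fix:
    "Some (g, A \<leftrightarrow> B) \<turnstile>\<^sub>\<omega> \<omega> : A \<leftrightarrow> B \<Longrightarrow> structurally_recursive g A \<omega> \<Longrightarrow>
     \<Psi> \<turnstile>\<^sub>\<omega> Fix g \<omega> : A \<leftrightarrow> B"


section \<open>Reversible primitive permutations\<close>

text \<open>Functions on \<open>\<int>\<^sup>k\<close> are extensional functions on the integer lists of length \<open>k\<close>.\<close>

definition vecs :: "nat \<Rightarrow> int list set" where
  "vecs k = {v. length v = k}"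

datatype rpp =
    RSucc
  | RPred
  | RId
  | RSign
  | RSwap
  | RSeq rpp rpp
  | RPar rpp rpp
  | RIt rpp
  | RIf rpp rpp rpp

text \<open>\<open>rpp_derives d k f\<close>: \<open>d\<close> is a derivation of \<open>f \<in> RPP\<^sup>k\<close>.\<close>

inductive rpp_derives :: "rpp \<Rightarrow> nat \<Rightarrow> (int list \<Rightarrow> int list) \<Rightarrow> bool" where
  "rpp_derives RSucc 1 (\<lambda>v\<in>vecs 1. [v ! 0 + 1])"
| "rpp_derives RPred 1 (\<lambda>v\<in>vecs 1. [v ! 0 - 1])"
| "rpp_derives RId 1 (\<lambda>v\<in>vecs 1. [v ! 0])"
| "rpp_derives RSign 1 (\<lambda>v\<in>vecs 1. [- (v ! 0)])"
| "rpp_derives RSwap 2 (\<lambda>v\<in>vecs 2. [v ! 1, v ! 0])"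
| "rpp_derives c k f \<Longrightarrow> rpp_derives d k g \<Longrightarrow>
   rpp_derives (RSeq c d) k (\<lambda>v\<in>vecs k. g (f v))"
| "rpp_derives c k f \<Longrightarrow> rpp_derives d l j \<Longrightarrow>
   rpp_derives (RPar c d) (k + l) (\<lambda>v\<in>vecs (k + l). f (take k v) @ j (drop k v))"
| "rpp_derives c k f \<Longrightarrow>
   rpp_derives (RIt c) (k + 1)
     (\<lambda>v\<in>vecs (k + 1). (f ^^ nat \<bar>last v\<bar>) (butlast v) @ [last v])"
| "rpp_derives b k f \<Longrightarrow> rpp_derives c k g \<Longrightarrow> rpp_derives d k h \<Longrightarrow>
   rpp_derives (RIf b c d) (k + 1)
     (\<lambda>v\<in>vecs (k + 1).
        (if last v > 0 then f (butlast v) else if last v = 0 then g (butlast v)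
         else h (butlast v)) @ [last v])"

definition RPP :: "nat \<Rightarrow> (int list \<Rightarrow> int list) set" where
  "RPP k = {f. \<exists>d. rpp_derives d k f}"

fun arity :: "rpp \<Rightarrow> nat" where
  "arity RSucc = 1"
| "arity RPred = 1"
| "arity RId = 1"
| "arity RSign = 1"
| "arity RSwap = 2"
| "arity (RSeq c d) = arity c"
| "arity (RPar c d) = arity c + arity d"
| "arity (RIt c) = arity c + 1"
| "arity (RIf b c d) = arity b + 1"


section \<open>Encoding into isos\<close>

definition npos :: ty where
  "npos = Mu (One \<oplus> TyVar 0)"

definition ZZ :: ty where
  "ZZ = One \<oplus> (npos \<oplus> npos)"

definition var_tuple :: "string \<Rightarrow> nat \<Rightarrow> var list" where
  "var_tuple s k = map (\<lambda>i. (s, i)) [0..<k]"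

text \<open>
  The value \<open>(x\<^sub>1, \<dots>, x\<^sub>n, v)\<close>, a flat \<open>(n + 1)\<close>-tuple. Accordingly \<open>Z\<^sup>k \<otimes> npos\<close> in the type
  of \<open>\<omega>\<^sub>a\<^sub>u\<^sub>x\<close> is \<open>tensor (replicate k ZZ @ [npos])\<close>.
\<close>

definition snoc_val :: "var list \<Rightarrow> val \<Rightarrow> val" where
  "snoc_val xs v = vtuple (map VVar xs @ [v])"

text \<open>
  All clauses of all isos use the same variable names; this is harmless because \<open>trm_App\<close> types an
  applied iso that is not a variable in empty contexts.
\<close>

definition iso_aux :: "nat \<Rightarrow> iso \<Rightarrow> iso" where
  "iso_aux k \<omega> =
    (let xs = var_tuple ''x'' k; ys = var_tuple ''y'' k; zs = var_tuple ''z'' k;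
         n = (''n'', 0); n' = (''m'', 0); g = ''g''
     in Fix g (Clauses
      [(snoc_val xs (VFold (VInl VUnit)),
        ELet (ptuple ys) \<omega> (ptuple xs) (EVal (snoc_val ys (VFold (VInl VUnit))))),
       (snoc_val xs (VFold (VInr (VVar n))),
        ELet (ptuple ys) \<omega> (ptuple xs)
         (ELet (ptuple (zs @ [n'])) (IVar g) (ptuple (ys @ [n]))
           (EVal (snoc_val zs (VFold (VInr (VVar n')))))))]))"

fun isos :: "rpp \<Rightarrow> iso" where
  "isos RId =
    (let x = VVar (''x'', 0) in Clauses [(x, EVal x)])"
| "isos RSwap =
    (let x = VVar (''x'', 0); y = VVar (''y'', 0) in Clauses [(VPair x y, EVal (VPair y x))])"
| "isos RSign =
    (let x = VVar (''x'', 0)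
     in Clauses
      [(VInr (VInl x), EVal (VInr (VInr x))),
       (VInr (VInr x), EVal (VInr (VInl x))),
       (VInl VUnit, EVal (VInl VUnit))])"
| "isos RSucc =
    (let x = VVar (''x'', 0)
     in Clauses
      [(VInl VUnit, EVal (VInr (VInl (VFold (VInl VUnit))))),
       (VInr (VInl x), EVal (VInr (VInl (VFold (VInr x))))),
       (VInr (VInr (VFold (VInl VUnit))), EVal (VInl VUnit)),
       (VInr (VInr (VFold (VInr x))), EVal (VInr (VInr x)))])"
| "isos RPred =
    (let x = VVar (''x'', 0)
     in Clauses
      [(VInr (VInl (VFold (VInl VUnit))), EVal (VInl VUnit)),
       (VInr (VInl (VFold (VInr x))), EVal (VInr (VInl x))),
       (VInl VUnit, EVal (VInr (VInr (VFold (VInl VUnit))))),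
       (VInr (VInr x), EVal (VInr (VInr (VFold (VInr x)))))])"
| "isos (RSeq c d) =
    (let k = arity c;
         xs = var_tuple ''x'' k; ys = var_tuple ''y'' k; zs = var_tuple ''z'' k
     in Clauses
      [(vtuple (map VVar xs),
        ELet (ptuple ys) (isos c) (ptuple xs)
         (ELet (ptuple zs) (isos d) (ptuple ys)
           (EVal (vtuple (map VVar zs)))))])"
| "isos (RPar c d) =
    (let j = arity c; k = arity d;
         xs = var_tuple ''x'' j; xs' = var_tuple ''z'' j;
         ys = var_tuple ''y'' k; ys' = var_tuple ''w'' k
     in Clauses
      [(vtuple (map VVar (xs @ ys)),
        ELet (ptuple xs') (isos c) (ptuple xs)
         (ELet (ptuple ys') (isos d) (ptuple ys)
           (EVal (vtuple (map VVar (xs' @ ys'))))))])"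
| "isos (RIt c) =
    (let k = arity c; \<omega> = iso_aux k (isos c);
         xs = var_tuple ''x'' k; ys = var_tuple ''y'' k; z = (''z'', 0); z' = (''w'', 0)
     in Clauses
      [(snoc_val xs (VInl VUnit), EVal (snoc_val xs (VInl VUnit))),
       (snoc_val xs (VInr (VInl (VVar z))),
        ELet (ptuple (ys @ [z'])) \<omega> (ptuple (xs @ [z]))
         (EVal (snoc_val ys (VInr (VInl (VVar z')))))),
       (snoc_val xs (VInr (VInr (VVar z))),
        ELet (ptuple (ys @ [z'])) \<omega> (ptuple (xs @ [z]))
         (EVal (snoc_val ys (VInr (VInr (VVar z'))))))])"
| "isos (RIf b c d) =
    (let k = arity b; xs = var_tuple ''x'' k; xs' = var_tuple ''y'' k; z = (''z'', 0)
     in Clauses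
      [(snoc_val xs (VInr (VInl (VVar z))),
        ELet (ptuple xs') (isos b) (ptuple xs) (EVal (snoc_val xs' (VInr (VInl (VVar z)))))),
       (snoc_val xs (VInl VUnit),
        ELet (ptuple xs') (isos c) (ptuple xs) (EVal (snoc_val xs' (VInl VUnit)))),
       (snoc_val xs (VInr (VInr (VVar z))),
        ELet (ptuple xs') (isos d) (ptuple xs) (EVal (snoc_val xs' (VInr (VInr (VVar z))))))])"

end

theory Submission
  imports Defs
begin

section \<open>Tuples of variables with a distinguished last component\<close>

lemma ntuple_Cons: "xs \<noteq> [] \<Longrightarrow> ntuple c (x # xs) = c x (ntuple c xs)"
  by (cases xs) auto

lemma val_of_pat_ptuple: "xs \<noteq> [] \<Longrightarrow> val_of_pat (ptuple xs) = vtuple (map VVar xs)"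
proof (induction xs)
  case (Cons x xs)
  then show ?case by (cases "xs = []") (simp_all add: ntuple_Cons)
qed simp

text \<open>Together with the next equation this gives a recursion on the prefix that starts at the
  empty list, where a plain tuple is unspecified. Inductions on tuples therefore run on the prefix
  of \<open>snoc_val\<close>.\<close>

lemma snoc_val_Nil [simp]: "snoc_val [] v = v"
  by (simp add: snoc_val_def)

lemma snoc_val_Cons [simp]: "snoc_val (x # xs) v = VPair (VVar x) (snoc_val xs v)"
  by (simp add: snoc_val_def ntuple_Cons)

lemma snoc_val_inject [simp]: "snoc_val xs v = snoc_val xs w \<longleftrightarrow> v = w"
  by (induction xs) auto

lemma vtuple_snoc: "vtuple (map VVar (xs @ [y])) = snoc_val xs (VVar y)"
  by (simp add: snoc_val_def)


section \<open>Orthogonal decompositions\<close>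

text \<open>Equal lengths matter: otherwise the last value of the shorter tuple could be a pair that
  absorbs components of the longer one.\<close>

lemma snoc_val_eqD:
  assumes "length xs = length ys" "snoc_val xs v = snoc_val ys w"
  shows "xs = ys \<and> v = w"
  using assms by (induction xs ys rule: list_induct2) auto

text \<open>
  The variable tuple may depend on the value, because the right-hand sides of the clauses of
  \<open>iso_aux\<close> and \<open>isos (RIt c)\<close> do not all use the same variables. Two distinct variables are never
  orthogonal, so the split must be on the second component: its value determines the variable in
  the first.
\<close>

lemma OD_snoc:
  assumes "OD A S" "\<forall>v \<in> S. length (xs v) = length As"
  shows "OD (tensor (As @ [A])) ((\<lambda>v. snoc_val (xs v) v) ` S)"
  using assms(2)
proof (induction As arbitrary: xs)
  case Nil
  then show ?case using assms(1) by simp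
next
  case (Cons B As)
  \<comment> \<open>The relation on which the tensor rules of \<open>OD\<close> operate: the first
    variable paired with the rest of the tuple, both as functions of the last value.\<close>
  let ?R = "(\<lambda>v. (VVar (hd (xs v)), snoc_val (tl (xs v)) v)) ` S"
  have len: "length (tl (xs v)) = length As" if "v \<in> S" for v
    using Cons.prems that by simp
  have "{w. \<exists>u. (u, w) \<in> ?R} = (\<lambda>v. snoc_val (tl (xs v)) v) ` S"
    by auto
  then have "OD (tensor (As @ [A])) {w. \<exists>u. (u, w) \<in> ?R}"
    using Cons.IH[of "\<lambda>v. tl (xs v)"] len by simp
  moreover have "OD B {u. (u, w) \<in> ?R}" if w: "\<exists>u. (u, w) \<in> ?R" for w
  proof -
    obtain v where v: "v \<in> S" "w = snoc_val (tl (xs v)) v"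
      using w by auto
    have unique: "v' = v" if "v' \<in> S" "snoc_val (tl (xs v')) v' = w" for v'
      using that v len snoc_val_eqD by metis
    have "{u. (u, w) \<in> ?R} = {VVar (hd (xs v))}"
    proof (intro equalityI subsetI)
      fix u assume "u \<in> {u. (u, w) \<in> ?R}"
      then obtain v' where "v' \<in> S" "snoc_val (tl (xs v')) v' = w" "u = VVar (hd (xs v'))"
        by auto
      then show "u \<in> {VVar (hd (xs v))}"
        using unique[of v'] by simp
    qed (use v in auto)
    then show ?thesis
      by (simp add: OD_var)
  qed
  ultimately have "OD (B \<otimes> tensor (As @ [A])) {VPair u w |u w. (u, w) \<in> ?R}"
    by (intro OD_Tensor_right) auto
  moreover have "snoc_val (xs v) v = VPair (VVar (hd (xs v))) (snoc_val (tl (xs v)) v)"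
    if "v \<in> S" for v
    using Cons.prems that by (cases "xs v") auto
  then have "(\<lambda>v. snoc_val (xs v) v) ` S = (\<lambda>(u, w). VPair u w) ` ?R"
    by (simp add: image_image cong: image_cong_simp)
  moreover have "(\<lambda>(u, w). VPair u w) ` R = {VPair u w |u w. (u, w) \<in> R}" for R
    by auto
  ultimately show ?case
    by (simp add: ntuple_Cons)
qed

text \<open>A tuple of variables is a \<open>snoc_val\<close> whose last value is a variable, so
  \<open>OD_snoc\<close> applies to the singleton decomposition \<open>OD_var\<close>.\<close>

lemma OD_vtuple:
  assumes "length xs = length As" "xs \<noteq> []"
  shows "OD (tensor As) {vtuple (map VVar xs)}"
proof -
  obtain ys y where xs: "xs = ys @ [y]"
    using assms(2) by (cases xs rule: rev_cases) auto
  obtain Bs B where As: "As = Bs @ [B]"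
    using assms by (cases As rule: rev_cases) auto
  have "OD (tensor (Bs @ [B])) ((\<lambda>v. snoc_val ys v) ` {VVar y})"
    using assms by (intro OD_snoc OD_var) (auto simp: xs As)
  then show ?thesis
    by (simp only: xs As vtuple_snoc image_insert image_empty)
qed


section \<open>Typing of tuples and lets\<close>

text \<open>\<open>map_of\<close> of an appended list adds the two maps in reverse order; freshness
  of \<open>x\<close> makes the domains disjoint, so the sum commutes.\<close>

lemma map_of_zip_snoc:
  assumes "length xs = length As" "x \<notin> set xs"
  shows "map_of (zip (xs @ [x]) (As @ [A])) = map_of (zip xs As) ++ [x \<mapsto> A]"
  using assms by (simp add: map_of_append map_add_comm)

text \<open>The linear context splits into one binding per prefix variable and the context \<Delta>
  of the last value, which \<open>trm_Pair\<close> peels off one by one.\<close>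

lemma snoc_val_typing:
  assumes "length xs = length As" "distinct xs" "\<forall>B \<in> set As. ty_closed B"
    and "\<Delta>, \<Psi> \<turnstile>\<^sub>e trm_of_val v : A" "set xs \<inter> dom \<Delta> = {}"
  shows "map_of (zip xs As) ++ \<Delta>, \<Psi> \<turnstile>\<^sub>e trm_of_val (snoc_val xs v) : tensor (As @ [A])"
  using assms
proof (induction xs As rule: list_induct2)
  case (Cons x xs B Bs)
  have "[x \<mapsto> B] ++ (map_of (zip xs Bs) ++ \<Delta>), \<Psi> \<turnstile>\<^sub>e
      TPair (TVar x) (trm_of_val (snoc_val xs v)) : B \<otimes> tensor (Bs @ [A])"
    using Cons by (intro trm_Pair trm_Var) auto
  \<comment> \<open>\<open>map_of\<close> adds the binding of \<open>x\<close> on the right, whereas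
    \<open>trm_Pair\<close> yields it on the left; distinctness allows the exchange.\<close>
  moreover have "map_of (zip (x # xs) (B # Bs)) = [x \<mapsto> B] ++ map_of (zip xs Bs)"
    using Cons map_add_comm[of "[x \<mapsto> B]" "map_of (zip xs Bs)"] by simp
  ultimately show ?case
    by (simp only: map_add_assoc) (simp add: ntuple_Cons)
qed simp

lemma vtuple_typing:
  assumes "length xs = length As" "xs \<noteq> []" "distinct xs" "\<forall>B \<in> set As. ty_closed B"
  shows "map_of (zip xs As), \<Psi> \<turnstile>\<^sub>e trm_of_val (vtuple (map VVar xs)) : tensor As"
proof -
  obtain ys y where xs: "xs = ys @ [y]"
    using assms(2) by (cases xs rule: rev_cases) auto
  obtain Bs B where As: "As = Bs @ [B]"
    using assms by (cases As rule: rev_cases) auto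
  have "map_of (zip ys Bs) ++ [y \<mapsto> B], \<Psi> \<turnstile>\<^sub>e trm_of_val (snoc_val ys (VVar y)) : tensor (Bs @ [B])"
    using assms by (intro snoc_val_typing) (auto simp: xs As intro: trm_Var)
  then show ?thesis
    using assms map_of_zip_snoc[of ys Bs y B] unfolding xs As vtuple_snoc by simp
qed

text \<open>The context \<Delta> is the frame: the call consumes exactly \<open>xs\<close>, the let
  binds \<open>ys\<close>, and \<Delta> passes on to the body. Premise and conclusion have the same
  shape, so nested lets are typed from the inside out. The disjunction covers the two application
  rules \<open>trm_App\<close> and \<open>trm_App_var\<close>.\<close>

lemma ELet_typing:
  assumes "(None \<turnstile>\<^sub>\<omega> \<omega> : tensor As \<leftrightarrow> tensor Bs) \<or>
      (\<exists>g. \<omega> = IVar g \<and> (\<Psi> \<turnstile>\<^sub>\<omega> \<omega> : tensor As \<leftrightarrow> tensor Bs))"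
    and "map_of (zip ys Bs) ++ \<Delta>, \<Psi> \<turnstile>\<^sub>e trm_of_exp e : C"
    and "length xs = length As" "xs \<noteq> []" "distinct xs" "\<forall>A \<in> set As. ty_closed A"
    and "length ys = length Bs" "ys \<noteq> []" "distinct ys"
    and "set xs \<inter> dom \<Delta> = {}" "set ys \<inter> dom \<Delta> = {}"
  shows "map_of (zip xs As) ++ \<Delta>, \<Psi> \<turnstile>\<^sub>e trm_of_exp (ELet (ptuple ys) \<omega> (ptuple xs) e) : C"
proof -
  have "map_of (zip xs As), \<Psi> \<turnstile>\<^sub>e trm_of_val (val_of_pat (ptuple xs)) : tensor As"
    using vtuple_typing assms by (simp add: val_of_pat_ptuple)
  then have "map_of (zip xs As), \<Psi> \<turnstile>\<^sub>e TApp \<omega> (trm_of_val (val_of_pat (ptuple xs))) : tensor Bs"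
    using assms(1) by (auto intro: trm_App trm_App_var)
  moreover have "\<Delta> ++ map_of (zip ys Bs), \<Psi> \<turnstile>\<^sub>e trm_of_exp e : C"
    using assms by (subst map_add_comm) auto
  moreover have "dom (map_of (zip xs As)) = set xs"
    using assms by simp
  ultimately show ?thesis
    unfolding trm_of_exp.simps using assms by (intro trm_Let) (auto simp del: dom_map_of_zip)
qed

text \<open>The premise of \<open>iso_clauses\<close> for one clause, isolated so that each clause
  can be typed separately with its own context.\<close>

definition clause_typing :: "ictxt \<Rightarrow> ty \<Rightarrow> ty \<Rightarrow> val \<times> exp \<Rightarrow> bool" where
  "clause_typing \<Psi> A B c \<longleftrightarrow>
     (\<exists>\<Delta>. (\<Delta>, None \<turnstile>\<^sub>e trm_of_val (fst c) : A) \<and> (\<Delta>, \<Psi> \<turnstile>\<^sub>e trm_of_exp (snd c) : B))"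

lemma clause_typingI:
  "\<Delta>, None \<turnstile>\<^sub>e trm_of_val v : A \<Longrightarrow> \<Delta>, \<Psi> \<turnstile>\<^sub>e trm_of_exp e : B \<Longrightarrow> clause_typing \<Psi> A B (v, e)"
  by (auto simp: clause_typing_def)

lemma Clauses_typing:
  assumes "list_all (clause_typing \<Psi> A B) cs"
    and "distinct (map fst cs)" "OD A (set (map fst cs))"
    and "distinct (map (Val \<circ> snd) cs)" "OD B (set (map (Val \<circ> snd) cs))"
  shows "\<Psi> \<turnstile>\<^sub>\<omega> Clauses cs : A \<leftrightarrow> B"
  using assms by (intro iso_clauses) (force simp: clause_typing_def list_all_iff)+

text \<open>The pattern shared by the clauses of \<open>RIf\<close> and the base clause of
  \<open>iso_aux\<close>: \<omega> transforms the tuple while \<open>v\<close> passes by. The typing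
  of \<open>v\<close> is required in every iso-context because \<open>v\<close> is typed in the
  empty one on the left and under \<Psi> on the right.\<close>

lemma clause_typing_let_snoc:
  assumes "None \<turnstile>\<^sub>\<omega> \<omega> : tensor As \<leftrightarrow> tensor As" "\<forall>A \<in> set As. ty_closed A"
    and "\<And>\<Phi>. \<Delta>, \<Phi> \<turnstile>\<^sub>e trm_of_val v : B"
    and "length xs = length As" "xs \<noteq> []" "distinct xs" "set xs \<inter> dom \<Delta> = {}"
    and "length ys = length As" "distinct ys" "set ys \<inter> dom \<Delta> = {}"
  shows "clause_typing \<Psi> (tensor (As @ [B])) (tensor (As @ [B]))
    (snoc_val xs v, ELet (ptuple ys) \<omega> (ptuple xs) (EVal (snoc_val ys v)))"
proof (rule clause_typingI)
  show "map_of (zip xs As) ++ \<Delta>, None \<turnstile>\<^sub>e trm_of_val (snoc_val xs v) : tensor (As @ [B])"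
    using assms by (intro snoc_val_typing)
  have "map_of (zip ys As) ++ \<Delta>, \<Psi> \<turnstile>\<^sub>e trm_of_val (snoc_val ys v) : tensor (As @ [B])"
    using assms by (intro snoc_val_typing)
  then show "map_of (zip xs As) ++ \<Delta>, \<Psi> \<turnstile>\<^sub>e
      trm_of_exp (ELet (ptuple ys) \<omega> (ptuple xs) (EVal (snoc_val ys v))) : tensor (As @ [B])"
    using assms by - (rule ELet_typing[where Bs = "As"]; auto)
qed


section \<open>Typing of the encoding\<close>

lemma ty_closed_npos [simp]: "ty_closed npos"
  by (simp add: npos_def)

lemma ty_closed_ZZ [simp]: "ty_closed ZZ"
  by (simp add: ZZ_def)

lemma unfold_mu_npos [simp]: "unfold_mu (One \<oplus> TyVar 0) = One \<oplus> npos"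
  by (simp add: unfold_mu_def npos_def)

lemma length_var_tuple [simp]: "length (var_tuple s k) = k"
  by (simp add: var_tuple_def)

lemma var_tuple_eq_Nil [simp]: "var_tuple s k = [] \<longleftrightarrow> k = 0"
  by (simp add: var_tuple_def)

lemma distinct_var_tuple [simp]: "distinct (var_tuple s k)"
  by (auto simp: var_tuple_def distinct_map inj_on_def)

lemma set_var_tuple: "set (var_tuple s k) = {s} \<times> {..<k}"
  by (auto simp: var_tuple_def)

lemma trm_Fold_npos: "\<Delta>, \<Psi> \<turnstile>\<^sub>e t : One \<oplus> npos \<Longrightarrow> \<Delta>, \<Psi> \<turnstile>\<^sub>e TFold t : npos"
  unfolding npos_def by (rule trm_Fold) (simp_all add: npos_def[symmetric])

lemmas value_typing = trm_Inl trm_Inr trm_Unit trm_Var trm_Fold_npos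

text \<open>The split of a positive number into one and successor.\<close>

lemma OD_npos: "OD npos {VFold (VInl VUnit), VFold (VInr (VVar x))}"
proof -
  have "OD (One \<oplus> npos) (VInl ` {VUnit} \<union> VInr ` {VVar x})"
    by (intro OD_Sum OD_One OD_var)
  then have "OD npos (VFold ` (VInl ` {VUnit} \<union> VInr ` {VVar x}))"
    unfolding npos_def by (intro OD_Mu) (simp add: npos_def[symmetric])
  then show ?thesis by (simp add: insert_commute)
qed

text \<open>Decompositions of the positive and of the negative integers combine with the single
  value for zero.\<close>

lemma OD_ZZ:
  assumes "OD npos S" "OD npos T"
  shows "OD ZZ (insert (VInl VUnit) (VInr ` (VInl ` S \<union> VInr ` T)))"
proof -
  have "OD ZZ (VInl ` {VUnit} \<union> VInr ` (VInl ` S \<union> VInr ` T))"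
    unfolding ZZ_def using assms by (intro OD_Sum OD_One)
  then show ?thesis by simp
qed

section \<open>The auxiliary iso for iteration\<close>

lemma isos_neq_IVar [simp]: "isos d \<noteq> IVar g"
  by (cases d) (simp_all add: Let_def)

text \<open>Nested iterations reuse the name \<open>g\<close>, but each occurrence lies below its
  own \<open>Fix\<close> and is not counted. With the preceding lemma, inserting an encoded iso into
  the body of \<open>iso_aux\<close> adds no recursive call.\<close>

lemma iso_calls_isos [simp]: "iso_calls ''g'' (isos d) = {}"
  by (induction d) (simp_all add: Let_def iso_aux_def)

lemma val_vars_ptuple:
  "xs \<noteq> [] \<Longrightarrow> val_vars (val_of_pat (ptuple xs)) = set xs"
proof (induction xs)
  case (Cons x xs)
  then show ?case by (cases "xs = []") (simp_all add: ntuple_Cons)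
qed simp

text \<open>The recursion descends on the last component: the only recursive call receives
  \<open>n\<close> out of \<open>fold (inr n)\<close>. The last two hypotheses exclude calls hidden
  in \<omega>.\<close>

lemma iso_aux_typing:
  assumes \<omega>: "None \<turnstile>\<^sub>\<omega> \<omega> : ty_power ZZ k \<leftrightarrow> ty_power ZZ k" and k: "k > 0"
    and [simp]: "\<omega> \<noteq> IVar ''g''" "iso_calls ''g'' \<omega> = {}"
  shows "None \<turnstile>\<^sub>\<omega> iso_aux k \<omega> :
    tensor (replicate k ZZ @ [npos]) \<leftrightarrow> tensor (replicate k ZZ @ [npos])"
proof -
  define Zs where "Zs = replicate k ZZ"
  let ?xs = "var_tuple ''x'' k" and ?ys = "var_tuple ''y'' k" and ?zs = "var_tuple ''z'' k"
  let ?n = "(''n'', 0)" and ?m = "(''m'', 0)"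
  let ?T = "tensor (Zs @ [npos])"
  let ?\<Psi> = "Some (''g'', ?T \<leftrightarrow> ?T)"
  let ?v1 = "snoc_val ?xs (VFold (VInl VUnit))"
  let ?v2 = "snoc_val ?xs (VFold (VInr (VVar ?n)))"
  let ?e1 = "ELet (ptuple ?ys) \<omega> (ptuple ?xs) (EVal (snoc_val ?ys (VFold (VInl VUnit))))"
  let ?e3 = "ELet (ptuple (?zs @ [?m])) (IVar ''g'') (ptuple (?ys @ [?n]))
    (EVal (snoc_val ?zs (VFold (VInr (VVar ?m)))))"
  let ?e2 = "ELet (ptuple ?ys) \<omega> (ptuple ?xs) ?e3"
  let ?cs = "[(?v1, ?e1), (?v2, ?e2)]"
  have Zs [simp]: "length Zs = k" "\<forall>A \<in> set Zs. ty_closed A"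
    by (auto simp: Zs_def)
  have closed: "ty_closed (tensor As)" if "As \<noteq> []" "\<forall>A \<in> set As. ty_closed A" for As
    using that
  proof (induction As)
    case (Cons A As)
    then show ?case by (cases "As = []") (simp_all add: ntuple_Cons)
  qed simp
  have \<omega>': "None \<turnstile>\<^sub>\<omega> \<omega> : tensor Zs \<leftrightarrow> tensor Zs"
    using \<omega> by (simp add: ty_power_def Zs_def)
  have g: "?\<Psi> \<turnstile>\<^sub>\<omega> IVar ''g'' : ?T \<leftrightarrow> ?T"
    by (intro iso_var closed) auto
  have t2: "map_of (zip xs Zs) ++ [x \<mapsto> npos], \<Psi> \<turnstile>\<^sub>e
      trm_of_val (snoc_val xs (VFold (VInr (VVar x)))) : ?T"
    if "length xs = k" "distinct xs" "x \<notin> set xs" for xs x \<Psi>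
    using that by (intro snoc_val_typing) (auto intro!: value_typing)
  have c1: "clause_typing ?\<Psi> ?T ?T (?v1, ?e1)"
    using k by (intro clause_typing_let_snoc[where \<Delta> = Map.empty] \<omega>') (auto intro!: value_typing)
  \<comment> \<open>The recursive call consumes the whole context, so the frame is empty here; in
    the outer let the frame is the binding of \<open>n\<close>.\<close>
  have "map_of (zip (?ys @ [?n]) (Zs @ [npos])) ++ Map.empty, ?\<Psi> \<turnstile>\<^sub>e trm_of_exp ?e3 : ?T"
    using g t2[of ?zs ?m ?\<Psi>]
    by (intro ELet_typing) (auto simp: map_of_zip_snoc set_var_tuple simp del: zip_append)
  then have "map_of (zip ?ys Zs) ++ [?n \<mapsto> npos], ?\<Psi> \<turnstile>\<^sub>e trm_of_exp ?e3 : ?T"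
    by (simp add: map_of_zip_snoc set_var_tuple del: zip_append trm_of_exp.simps)
  then have "map_of (zip ?xs Zs) ++ [?n \<mapsto> npos], ?\<Psi> \<turnstile>\<^sub>e trm_of_exp ?e2 : ?T"
    using k \<omega>' by (intro ELet_typing) (auto simp: set_var_tuple)
  then have c2: "clause_typing ?\<Psi> ?T ?T (?v2, ?e2)"
    using t2[of ?xs ?n None] by (intro clause_typingI) (auto simp: set_var_tuple)
  \<comment> \<open>Two tuples are allowed because the right-hand sides end with \<open>ys\<close>
    in the base clause and with \<open>zs\<close> in the recursive one. The updated function selects
    the tuple by the last value.\<close>
  have OD: "OD ?T {snoc_val xs (VFold (VInl VUnit)), snoc_val ys (VFold (VInr (VVar x)))}"
    if "length xs = k" "length ys = k" for xs ys x
  proof -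
    show ?thesis
      using that OD_npos OD_snoc[of npos "{VFold (VInl VUnit), VFold (VInr (VVar x))}"
          "(\<lambda>_. ys)(VFold (VInl VUnit) := xs)" Zs] by simp
  qed
  \<comment> \<open>Distinctness on the right-hand side: equality would identify \<open>inl\<close>
    with \<open>inr\<close> in the last component.\<close>
  have "snoc_val ?ys (VFold (VInl VUnit)) \<noteq> snoc_val ?zs (VFold (VInr (VVar ?m)))"
    using snoc_val_eqD[of ?ys ?zs] by auto
  then have "?\<Psi> \<turnstile>\<^sub>\<omega> Clauses ?cs : ?T \<leftrightarrow> ?T"
    using c1 c2 OD[of ?xs ?xs] OD[of ?ys ?zs]
    by (intro Clauses_typing) (simp_all del: trm_of_exp.simps)
  moreover have "structurally_recursive ''g'' ?T (Clauses ?cs)"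
    unfolding structurally_recursive_def
  proof (intro exI conjI)
    \<comment> \<open>The index of the recursive argument is \<open>k\<close>, counted from 0: the
      component of type \<open>npos\<close> after the \<open>k\<close> integers.\<close>
    show "?T = tensor (Zs @ [npos])" "(Zs @ [npos]) ! k = Mu (One \<oplus> TyVar 0)"
      by (simp_all add: nth_append npos_def)
    show "\<forall>(v, e) \<in> set ?cs. \<exists>vs. length vs = length (Zs @ [npos]) \<and> v = vtuple vs \<and>
       (val_vars (vs ! k) = {} \<and> exp_calls ''g'' e = {} \<or>
        (\<forall>p \<in> exp_calls ''g'' e. \<exists>xs. length xs = length (Zs @ [npos]) \<and> p = ptuple xs \<and>
           VVar (xs ! k) \<in> strict_subvals (vs ! k) \<and> xs ! k \<notin> let_vars e))"
    proof -
      \<comment> \<open>Base clause: the last component is closed and \<omega> contributes no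
        call.\<close>
      have 1: "\<exists>vs. length vs = Suc k \<and> ?v1 = vtuple vs \<and>
          val_vars (vs ! k) = {} \<and> exp_calls ''g'' ?e1 = {}"
        by (rule exI[of _ "map VVar ?xs @ [VFold (VInl VUnit)]"])
          (simp add: snoc_val_def nth_append)
      \<comment> \<open>Recursive clause: \<open>n\<close> is a strict subvalue of the last
        component, and the lets bind only \<open>ys\<close>, \<open>zs\<close> and \<open>m\<close>,
        so it is not shadowed.\<close>
      have 2: "\<exists>vs. length vs = Suc k \<and> ?v2 = vtuple vs \<and>
          (\<forall>p \<in> exp_calls ''g'' ?e2. \<exists>xs. length xs = Suc k \<and> p = ptuple xs \<and>
            VVar (xs ! k) \<in> strict_subvals (vs ! k) \<and> xs ! k \<notin> let_vars ?e2)"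
      proof (intro exI conjI ballI)
        show "?v2 = vtuple (map VVar ?xs @ [VFold (VInr (VVar ?n))])"
          by (simp add: snoc_val_def)
        fix p assume "p \<in> exp_calls ''g'' ?e2"
        then show "p = ptuple (?ys @ [?n])"
          by simp
        show "(?ys @ [?n]) ! k \<notin> let_vars ?e2"
          using k by (auto simp: val_vars_ptuple nth_append set_var_tuple simp del: map_append)
      qed (simp_all add: nth_append)
      show ?thesis
        using 1 2 by (simp del: exp_calls.simps let_vars.simps) blast
    qed
  qed auto
  ultimately show ?thesis
    unfolding iso_aux_def Let_def Zs_def[symmetric] by (rule iso_fix)
qed

section \<open>Clauses of the primitives: closed values for 0, 1 and -1, then values with one
  variable\<close>

lemma clause_typing_VUnit:
  assumes "v \<in> {VInl VUnit, VInr (VInl (VFold (VInl VUnit))), VInr (VInr (VFold (VInl VUnit)))}"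
    and "w \<in> {VInl VUnit, VInr (VInl (VFold (VInl VUnit))), VInr (VInr (VFold (VInl VUnit)))}"
  shows "clause_typing None ZZ ZZ (v, EVal w)"
  using assms by (intro clause_typingI[of Map.empty]) (auto simp: ZZ_def intro!: value_typing)

text \<open>Both sides consist of a sign and a magnitude \<open>x\<close> or its successor, so the
  one binding of \<open>x\<close> to \<open>npos\<close> types either side.\<close>

lemma clause_typing_VVar:
  assumes "v \<in> {VInr (i u) |i u. i \<in> {VInl, VInr} \<and> u \<in> {VVar x, VFold (VInr (VVar x))}}"
    and "w \<in> {VInr (i u) |i u. i \<in> {VInl, VInr} \<and> u \<in> {VVar x, VFold (VInr (VVar x))}}"
  shows "clause_typing None ZZ ZZ (v, EVal w)"
  using assms
  by (intro clause_typingI[of "[x \<mapsto> npos]"]) (auto simp: ZZ_def intro!: value_typing)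

section \<open>Composition, iteration and selection\<close>

lemma isos_RSeq_typing:
  assumes k: "k > 0" "arity c = k"
    and "None \<turnstile>\<^sub>\<omega> isos c : ty_power ZZ k \<leftrightarrow> ty_power ZZ k"
    and "None \<turnstile>\<^sub>\<omega> isos d : ty_power ZZ k \<leftrightarrow> ty_power ZZ k"
  shows "None \<turnstile>\<^sub>\<omega> isos (RSeq c d) : ty_power ZZ k \<leftrightarrow> ty_power ZZ k"
proof -
  let ?xs = "var_tuple ''x'' k" and ?ys = "var_tuple ''y'' k" and ?zs = "var_tuple ''z'' k"
  let ?Zs = "replicate k ZZ"
  have IH: "None \<turnstile>\<^sub>\<omega> isos c : tensor ?Zs \<leftrightarrow> tensor ?Zs" "None \<turnstile>\<^sub>\<omega> isos d : tensor ?Zs \<leftrightarrow> tensor ?Zs"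
    using assms by (auto simp: ty_power_def)
  have t: "map_of (zip (var_tuple s k) ?Zs), None \<turnstile>\<^sub>e
      trm_of_val (vtuple (map VVar (var_tuple s k))) : tensor ?Zs" for s
    using k by (intro vtuple_typing) auto
  have OD: "OD (tensor ?Zs) {vtuple (map VVar (var_tuple s k))}" for s
    using k by (intro OD_vtuple) auto
  let ?e = "ELet (ptuple ?zs) (isos d) (ptuple ?ys) (EVal (vtuple (map VVar ?zs)))"
  \<comment> \<open>Each let consumes the complete tuple, hence the empty frame.\<close>
  have "map_of (zip ?ys ?Zs) ++ Map.empty, None \<turnstile>\<^sub>e trm_of_exp ?e : tensor ?Zs"
    using k(1) IH t[of "''z''"] by - (rule ELet_typing[where Bs = "?Zs"]; auto)
  then have "map_of (zip ?xs ?Zs) ++ Map.empty, None \<turnstile>\<^sub>e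
      trm_of_exp (ELet (ptuple ?ys) (isos c) (ptuple ?xs) ?e) : tensor ?Zs"
    using k(1) IH by - (rule ELet_typing[where Bs = "?Zs"]; auto simp del: trm_of_exp.simps)
  then have "clause_typing None (tensor ?Zs) (tensor ?Zs)
      (vtuple (map VVar ?xs), ELet (ptuple ?ys) (isos c) (ptuple ?xs) ?e)"
    using t by (intro clause_typingI[of "map_of (zip ?xs ?Zs)"]) simp_all
  then have "None \<turnstile>\<^sub>\<omega> isos (RSeq c d) : tensor ?Zs \<leftrightarrow> tensor ?Zs"
    unfolding isos.simps Let_def k using OD by (intro Clauses_typing) simp_all
  then show ?thesis using k by (simp add: ty_power_def)
qed

text \<open>The frames alternate: \<open>ys\<close> waits while the first iso runs, then its output
  \<open>zs\<close> waits while the second runs. The four name families are disjoint, so the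
  contexts commute.\<close>

lemma isos_RPar_typing:
  assumes k: "k > 0" "arity c = k" and l: "l > 0" "arity d = l"
    and "None \<turnstile>\<^sub>\<omega> isos c : ty_power ZZ k \<leftrightarrow> ty_power ZZ k"
    and "None \<turnstile>\<^sub>\<omega> isos d : ty_power ZZ l \<leftrightarrow> ty_power ZZ l"
  shows "None \<turnstile>\<^sub>\<omega> isos (RPar c d) : ty_power ZZ (k + l) \<leftrightarrow> ty_power ZZ (k + l)"
proof -
  let ?xs = "var_tuple ''x'' k" and ?zs = "var_tuple ''z'' k"
  let ?ys = "var_tuple ''y'' l" and ?ws = "var_tuple ''w'' l"
  let ?As = "replicate k ZZ" and ?Bs = "replicate l ZZ"
  let ?T = "tensor (?As @ ?Bs)"
  have IH: "None \<turnstile>\<^sub>\<omega> isos c : tensor ?As \<leftrightarrow> tensor ?As" "None \<turnstile>\<^sub>\<omega> isos d : tensor ?Bs \<leftrightarrow> tensor ?Bs"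
    using assms by (auto simp: ty_power_def)
  have t: "map_of (zip xs ?As) ++ map_of (zip ys ?Bs), None \<turnstile>\<^sub>e
      trm_of_val (vtuple (map VVar (xs @ ys))) : ?T"
    if "length xs = k" "length ys = l" "distinct (xs @ ys)" for xs ys
  proof -
    have "map_of (zip (xs @ ys) (?As @ ?Bs)) = map_of (zip xs ?As) ++ map_of (zip ys ?Bs)"
      using that by (simp add: map_of_append) (rule map_add_comm; auto)
    moreover have "map_of (zip (xs @ ys) (?As @ ?Bs)), None \<turnstile>\<^sub>e
        trm_of_val (vtuple (map VVar (xs @ ys))) : ?T"
      using that k by (intro vtuple_typing) auto
    ultimately show ?thesis by simp
  qed
  have OD: "OD ?T {vtuple (map VVar (xs @ ys))}" if "length xs = k" "length ys = l" for xs ys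
    using that k by (intro OD_vtuple) auto
  let ?e = "ELet (ptuple ?ws) (isos d) (ptuple ?ys) (EVal (vtuple (map VVar (?zs @ ?ws))))"
  have "map_of (zip ?ws ?Bs) ++ map_of (zip ?zs ?As), None \<turnstile>\<^sub>e
      trm_of_exp (EVal (vtuple (map VVar (?zs @ ?ws)))) : ?T"
    using t[of ?zs ?ws] by (subst map_add_comm) (auto simp: set_var_tuple)
  then have "map_of (zip ?ys ?Bs) ++ map_of (zip ?zs ?As), None \<turnstile>\<^sub>e trm_of_exp ?e : ?T"
    using l(1) IH(2) by - (rule ELet_typing[where Bs = "?Bs"]; auto simp: set_var_tuple)
  then have "map_of (zip ?zs ?As) ++ map_of (zip ?ys ?Bs), None \<turnstile>\<^sub>e trm_of_exp ?e : ?T"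
    by (subst map_add_comm) (auto simp: set_var_tuple)
  then have "map_of (zip ?xs ?As) ++ map_of (zip ?ys ?Bs), None \<turnstile>\<^sub>e
      trm_of_exp (ELet (ptuple ?zs) (isos c) (ptuple ?xs) ?e) : ?T"
    using k(1) IH(1) by - (rule ELet_typing[where Bs = "?As"]; auto simp: set_var_tuple)
  then have "clause_typing None ?T ?T
      (vtuple (map VVar (?xs @ ?ys)), ELet (ptuple ?zs) (isos c) (ptuple ?xs) ?e)"
    using t[of ?xs ?ys] by (intro clause_typingI) (auto simp: set_var_tuple)
  then have "None \<turnstile>\<^sub>\<omega> isos (RPar c d) : ?T \<leftrightarrow> ?T"
    unfolding isos.simps Let_def k l
    using OD[of ?xs ?ys] OD[of ?zs ?ws] by (intro Clauses_typing) simp_all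
  then show ?thesis using k l by (simp add: ty_power_def replicate_add)
qed

text \<open>Only the magnitude goes through \<open>iso_aux\<close>; the sign is stripped by the
  pattern and restored after the call. The zero clause is the identity.\<close>

lemma isos_RIt_typing:
  assumes k: "k > 0" "arity c = k"
    and "None \<turnstile>\<^sub>\<omega> isos c : ty_power ZZ k \<leftrightarrow> ty_power ZZ k"
  shows "None \<turnstile>\<^sub>\<omega> isos (RIt c) : ty_power ZZ (Suc k) \<leftrightarrow> ty_power ZZ (Suc k)"
proof -
  let ?xs = "var_tuple ''x'' k" and ?ys = "var_tuple ''y'' k"
  let ?z = "(''z'', 0)" and ?w = "(''w'', 0)"
  let ?Zs = "replicate k ZZ"
  let ?T = "tensor (?Zs @ [ZZ])"
  have aux: "None \<turnstile>\<^sub>\<omega> iso_aux k (isos c) : tensor (?Zs @ [npos]) \<leftrightarrow> tensor (?Zs @ [npos])"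
    using assms by (intro iso_aux_typing) auto
  \<comment> \<open>The constructor \<open>i\<close> treats both signs at once; a first name other
    than \<open>s\<close> makes \<open>x\<close> fresh for the tuple.\<close>
  have t: "map_of (zip (var_tuple s k @ [x]) (?Zs @ [npos])) ++ Map.empty, None \<turnstile>\<^sub>e
      trm_of_val (snoc_val (var_tuple s k) (VInr (i (VVar x)))) : ?T"
    if "fst x \<noteq> s" "i = VInl \<or> i = VInr" for s x i
  proof -
    have "map_of (zip (var_tuple s k) ?Zs) ++ [x \<mapsto> npos], None \<turnstile>\<^sub>e
        trm_of_val (snoc_val (var_tuple s k) (VInr (i (VVar x)))) : ?T"
      using that
      by (intro snoc_val_typing) (auto simp: set_var_tuple ZZ_def intro!: value_typing)
    moreover have "x \<notin> set (var_tuple s k)"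
      using that by (auto simp: set_var_tuple)
    ultimately show ?thesis
      using map_of_zip_snoc[of "var_tuple s k" ?Zs x npos] by simp
  qed
  have c: "clause_typing None ?T ?T (snoc_val ?xs (VInr (i (VVar ?z))),
      ELet (ptuple (?ys @ [?w])) (iso_aux k (isos c)) (ptuple (?xs @ [?z]))
        (EVal (snoc_val ?ys (VInr (i (VVar ?w))))))"
    if "i = VInl \<or> i = VInr" for i
  proof (rule clause_typingI)
    show "map_of (zip (?xs @ [?z]) (?Zs @ [npos])) ++ Map.empty, None \<turnstile>\<^sub>e
        trm_of_val (snoc_val ?xs (VInr (i (VVar ?z)))) : ?T"
      using that by (intro t) auto
    have "map_of (zip (?ys @ [?w]) (?Zs @ [npos])) ++ Map.empty, None \<turnstile>\<^sub>e
        trm_of_exp (EVal (snoc_val ?ys (VInr (i (VVar ?w))))) : ?T"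
      unfolding trm_of_exp.simps using that by (intro t) auto
    then show "map_of (zip (?xs @ [?z]) (?Zs @ [npos])) ++ Map.empty, None \<turnstile>\<^sub>e
        trm_of_exp (ELet (ptuple (?ys @ [?w])) (iso_aux k (isos c)) (ptuple (?xs @ [?z]))
          (EVal (snoc_val ?ys (VInr (i (VVar ?w)))))) : ?T"
      using aux by - (rule ELet_typing[where Bs = "?Zs @ [npos]"]; auto simp: set_var_tuple)
  qed
  have "map_of (zip ?xs ?Zs) ++ Map.empty, None \<turnstile>\<^sub>e
      trm_of_val (snoc_val ?xs (VInl VUnit)) : ?T"
    by (intro snoc_val_typing) (auto simp: ZZ_def intro!: value_typing)
  then have c0: "clause_typing None ?T ?T (snoc_val ?xs (VInl VUnit), EVal (snoc_val ?xs (VInl VUnit)))"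
    by (intro clause_typingI) auto
  \<comment> \<open>On the right the zero clause keeps \<open>xs\<close> while the signed clauses
    return \<open>ys\<close>; the instance with \<open>xs\<close> throughout serves the
    left.\<close>
  have OD: "OD ?T {snoc_val ?xs (VInl VUnit), snoc_val ys (VInr (VInl (VVar x))),
      snoc_val ys (VInr (VInr (VVar x)))}" if "length ys = k" for ys x
    using that OD_ZZ[OF OD_var[of _ x] OD_var[of _ x]]
      OD_snoc[of ZZ "{VInl VUnit, VInr (VInl (VVar x)), VInr (VInr (VVar x))}"
          "(\<lambda>_. ys)(VInl VUnit := ?xs)" ?Zs]
    by (simp add: insert_commute)
  have "snoc_val ?xs (VInl VUnit) \<noteq> snoc_val ?ys (VInr v)" for v
    using snoc_val_eqD[of ?xs ?ys] by auto
  then have "None \<turnstile>\<^sub>\<omega> isos (RIt c) : ?T \<leftrightarrow> ?T"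
    unfolding isos.simps Let_def k
    using c0 c[of VInl] c[of VInr] OD[of ?xs] OD[of ?ys]
    by (intro Clauses_typing) simp_all
  then show ?thesis using k by (simp add: ty_power_def replicate_append_same)
qed

lemma isos_RIf_typing:
  assumes k: "k > 0" "arity b = k"
    and "None \<turnstile>\<^sub>\<omega> isos b : ty_power ZZ k \<leftrightarrow> ty_power ZZ k"
    and "None \<turnstile>\<^sub>\<omega> isos c : ty_power ZZ k \<leftrightarrow> ty_power ZZ k"
    and "None \<turnstile>\<^sub>\<omega> isos d : ty_power ZZ k \<leftrightarrow> ty_power ZZ k"
  shows "None \<turnstile>\<^sub>\<omega> isos (RIf b c d) : ty_power ZZ (Suc k) \<leftrightarrow> ty_power ZZ (Suc k)"
proof -
  let ?xs = "var_tuple ''x'' k" and ?ys = "var_tuple ''y'' k" and ?z = "(''z'', 0)"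
  let ?Zs = "replicate k ZZ"
  let ?T = "tensor (?Zs @ [ZZ])"
  have IH: "None \<turnstile>\<^sub>\<omega> isos b : tensor ?Zs \<leftrightarrow> tensor ?Zs"
      "None \<turnstile>\<^sub>\<omega> isos c : tensor ?Zs \<leftrightarrow> tensor ?Zs" "None \<turnstile>\<^sub>\<omega> isos d : tensor ?Zs \<leftrightarrow> tensor ?Zs"
    using assms by (auto simp: ty_power_def)
  \<comment> \<open>The frame holds at most \<open>z\<close>: it is empty in the zero clause and
    binds \<open>z\<close> to \<open>npos\<close> in the signed ones.\<close>
  have c: "clause_typing None ?T ?T
      (snoc_val ?xs v, ELet (ptuple ?ys) \<omega> (ptuple ?xs) (EVal (snoc_val ?ys v)))"
    if "None \<turnstile>\<^sub>\<omega> \<omega> : tensor ?Zs \<leftrightarrow> tensor ?Zs" "\<And>\<Phi>. \<Delta>, \<Phi> \<turnstile>\<^sub>e trm_of_val v : ZZ" "dom \<Delta> \<subseteq> {?z}"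
    for \<omega> v \<Delta>
    using k that by (intro clause_typing_let_snoc[where \<Delta> = \<Delta>]) (auto simp: set_var_tuple)
  have c': "clause_typing None ?T ?T (snoc_val ?xs (VInr (VInl (VVar ?z))),
        ELet (ptuple ?ys) (isos b) (ptuple ?xs) (EVal (snoc_val ?ys (VInr (VInl (VVar ?z))))))"
      "clause_typing None ?T ?T (snoc_val ?xs (VInl VUnit),
        ELet (ptuple ?ys) (isos c) (ptuple ?xs) (EVal (snoc_val ?ys (VInl VUnit))))"
      "clause_typing None ?T ?T (snoc_val ?xs (VInr (VInr (VVar ?z))),
        ELet (ptuple ?ys) (isos d) (ptuple ?xs) (EVal (snoc_val ?ys (VInr (VInr (VVar ?z))))))"
    by (rule c[OF IH(1), of "[?z \<mapsto> npos]"] c[OF IH(2), of Map.empty]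
        c[OF IH(3), of "[?z \<mapsto> npos]"]; auto simp: ZZ_def intro!: value_typing)+
  have OD: "OD ?T {snoc_val xs (VInr (VInl (VVar ?z))), snoc_val xs (VInl VUnit),
      snoc_val xs (VInr (VInr (VVar ?z)))}" if "length xs = k" for xs
    using that OD_ZZ[OF OD_var[of _ ?z] OD_var[of _ ?z]]
      OD_snoc[of ZZ "{VInr (VInl (VVar ?z)), VInl VUnit, VInr (VInr (VVar ?z))}" "\<lambda>_. xs" ?Zs]
    by (simp add: insert_commute)
  have "None \<turnstile>\<^sub>\<omega> isos (RIf b c d) : ?T \<leftrightarrow> ?T"
    unfolding isos.simps Let_def k
    using c' OD[of ?xs] OD[of ?ys] by (intro Clauses_typing) simp_all
  then show ?thesis using k by (simp add: ty_power_def replicate_append_same)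
qed

text \<open>The induction carries two further facts: \<open>k > 0\<close>, since the empty tuple is
  unspecified, and \<open>arity d = k\<close>, since \<open>isos\<close> reads tuple lengths off
  \<open>arity\<close>.\<close>

lemma isos_typing:
  assumes "rpp_derives d k f"
  shows "k > 0 \<and> arity d = k \<and> (None \<turnstile>\<^sub>\<omega> isos d : ty_power ZZ k \<leftrightarrow> ty_power ZZ k)"
  using assms
proof induction
  case 1
  have "None \<turnstile>\<^sub>\<omega> isos RSucc : ZZ \<leftrightarrow> ZZ"
    unfolding isos.simps Let_def
    \<comment> \<open>For the successor the left-hand sides split the negative part and the
      right-hand sides the positive part; for the predecessor it is the reverse.\<close>
    using OD_ZZ[OF OD_var OD_npos] OD_ZZ[OF OD_npos OD_var]
    by (intro Clauses_typing) (auto simp: insert_commute intro: clause_typing_VUnit clause_typing_VVar)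
  then show ?case by (simp add: ty_power_def)
next
  case 2
  have "None \<turnstile>\<^sub>\<omega> isos RPred : ZZ \<leftrightarrow> ZZ"
    unfolding isos.simps Let_def
    using OD_ZZ[OF OD_var OD_npos] OD_ZZ[OF OD_npos OD_var]
    by (intro Clauses_typing) (auto simp: insert_commute intro: clause_typing_VUnit clause_typing_VVar)
  then show ?case by (simp add: ty_power_def)
next
  case 3
  have "clause_typing None ZZ ZZ (VVar x, EVal (VVar x))" for x
    by (rule clause_typingI) (auto intro!: trm_Var)
  then have "None \<turnstile>\<^sub>\<omega> isos RId : ZZ \<leftrightarrow> ZZ"
    unfolding isos.simps Let_def by (intro Clauses_typing) (auto intro: OD_var)
  then show ?case by (simp add: ty_power_def)
next
  case 4
  have "None \<turnstile>\<^sub>\<omega> isos RSign : ZZ \<leftrightarrow> ZZ"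
    unfolding isos.simps Let_def
    using OD_ZZ[OF OD_var OD_var]
    by (intro Clauses_typing) (auto simp: insert_commute intro: clause_typing_VUnit clause_typing_VVar)
  then show ?case by (simp add: ty_power_def)
next
  case 5
  let ?x = "(''x'', 0)" and ?y = "(''y'', 0)"
  have t: "map_of (zip [x, y] [ZZ, ZZ]), None \<turnstile>\<^sub>e
      trm_of_val (vtuple (map VVar [x, y])) : tensor [ZZ, ZZ]"
    if "x \<noteq> y" for x y
    using that by (intro vtuple_typing) auto
  have OD: "OD (tensor [ZZ, ZZ]) {vtuple (map VVar [x, y])}" for x y
    by (rule OD_vtuple) auto
  have "clause_typing None (tensor [ZZ, ZZ]) (tensor [ZZ, ZZ])
      (VPair (VVar ?x) (VVar ?y), EVal (VPair (VVar ?y) (VVar ?x)))"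
    \<comment> \<open>Both orders of the pair are typed in the same context, as updates at distinct
      variables commute.\<close>
    using t[of ?x ?y] t[of ?y ?x]
    by (intro clause_typingI[of "map_of (zip [?x, ?y] [ZZ, ZZ])"]) (simp_all add: fun_upd_twist)
  then have "None \<turnstile>\<^sub>\<omega> isos RSwap : tensor [ZZ, ZZ] \<leftrightarrow> tensor [ZZ, ZZ]"
    unfolding isos.simps Let_def
    using OD[of ?x ?y] OD[of ?y ?x] by (intro Clauses_typing) simp_all
  then show ?case by (simp add: ty_power_def numeral_2_eq_2)
qed (simp_all add: isos_RSeq_typing isos_RPar_typing isos_RIt_typing isos_RIf_typing del: isos.simps)

theorem mainTheorem8:
  fixes k :: nat and f :: "int list \<Rightarrow> int list" and d :: rpp
  assumes "f \<in> RPP k"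
    and "rpp_derives d k f"
  shows "None \<turnstile>\<^sub>\<omega> isos d : ty_power ZZ k \<leftrightarrow> ty_power ZZ k"
  using isos_typing[OF assms(2)] by simp

end
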